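(* If a symmetric $0,1$-matrix $M$ admits a sequence of symmetric $k$-diagonal divisions, then $\mathrm{stw}(M)\leq 4k^3$.
   Context: Let $M$ be a symmetric $n\times n$ $0,1$-matrix with rows $r_1,\dots,r_n$ and columns $c_1,\dots,c_n$. A symmetric partition of $M$ is a pair $(\mathcal R,\mathcal C)$ with $\mathcal R$ a partition of the rows and $\mathcal C$ a partition of the columns such that $r_i,r_j$ lie in the same part iff $c_i,c_j$ do; each row part $R$ has a symmetric column part. The zone $R\cap C$ is the submatrix with rows $R$ and columns $C$; it is non-constant if it contains two distinct entries. A symmetric partition sequence of $M$ is a sequence of symmetric partitions starting with the partition into singletons, ending with one row part and one column part, each obtained from the previous one by merging two row parts and the two symmetric column parts. The span of a set of columns (rows) is the set of columns (rows) with index between its minimum and maximum index; two sets conflict if their spans intersect. The stretch value of a row part $R$ is the number of column parts conflicting with the union of all column parts $C$ such that $C$ is the symmetric of $R$ or $R\cap C$ is non-constant; symmetrically for column parts; the stretch value of a partition is the maximum over its parts. $\mathrm{stw}(M)$ is the minimum over symmetric partition sequences of the maximum stretch value of a partition in the sequence. A division is a symmetric partition whose parts consist of consecutive rows (columns), written $(R_1,\dots,R_p)$, $(C_1,\dots,C_p)$ in order. A row part $R_i$ is $k$-wide if for every $k$ consecutive column parts $C_j,\dots,C_{j+k-1}$ with $j\le i\le j+k-1$, the submatrix with rows $R_i$ and all columns outside $C_j\cup\dots\cup C_{j+k-1}$ has at least $k$ distinct rows; symmetrically for column parts. A division is $k$-diagonal if none of its row and column parts is $k$-wide. A sequence of symmetric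 $k$-diagonal divisions is a symmetric partition sequence each of whose partitions is a $k$-diagonal division. *)

theory Defs
  imports "Jordan_Normal_Form.DL_Submatrix" "HOL-Library.Disjoint_Sets"
begin

text \<open>
  Rows and columns are represented by their indices, counted from 0. Thus the column part
  symmetric to a row part is the same set of indices, and a symmetric partition is a pair
  (row parts, column parts).
\<close>

type_synonym sympart = "nat set set \<times> nat set set"

definition symmetric_partition :: "nat \<Rightarrow> sympart \<Rightarrow> bool" where
  "symmetric_partition n P \<longleftrightarrow>
     partition_on {..<n} (fst P) \<and> partition_on {..<n} (snd P) \<and>
     (\<forall>i<n. \<forall>j<n. (\<exists>R\<in>fst P. i \<in> R \<and> j \<in> R) \<longleftrightarrow> (\<exists>C\<in>snd P. i \<in> C \<and> j \<in> C))"

definition singleton_partition :: "nat \<Rightarrow> sympart" where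
  "singleton_partition n = ((\<lambda>i. {i}) ` {..<n}, (\<lambda>i. {i}) ` {..<n})"

definition merge_step :: "sympart \<Rightarrow> sympart \<Rightarrow> bool" where
  "merge_step P Q \<longleftrightarrow>
     (\<exists>A B. A \<noteq> B \<and> {A, B} \<subseteq> fst P \<and> {A, B} \<subseteq> snd P \<and>
        fst Q = insert (A \<union> B) (fst P - {A, B}) \<and>
        snd Q = insert (A \<union> B) (snd P - {A, B}))"

definition symmetric_partition_sequence :: "nat \<Rightarrow> sympart list \<Rightarrow> bool" where
  "symmetric_partition_sequence n Ps \<longleftrightarrow>
     Ps \<noteq> [] \<and> (\<forall>P\<in>set Ps. symmetric_partition n P) \<and>
     hd Ps = singleton_partition n \<and>
     card (fst (last Ps)) = 1 \<and> card (snd (last Ps)) = 1 \<and>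
     (\<forall>t. Suc t < length Ps \<longrightarrow> merge_step (Ps ! t) (Ps ! Suc t))"

definition nonconstant_zone :: "'a mat \<Rightarrow> nat set \<Rightarrow> nat set \<Rightarrow> bool" where
  "nonconstant_zone M R C \<longleftrightarrow>
     (\<exists>x\<in>elements_mat (submatrix M R C). \<exists>y\<in>elements_mat (submatrix M R C). x \<noteq> y)"

text \<open>Spans are only taken of finite nonempty sets (parts and unions of parts).\<close>

definition index_span :: "nat set \<Rightarrow> nat set" where
  "index_span S = {Min S..Max S}"

definition conflict :: "nat set \<Rightarrow> nat set \<Rightarrow> bool" where
  "conflict S T \<longleftrightarrow> index_span S \<inter> index_span T \<noteq> {}"

definition row_stretch :: "'a mat \<Rightarrow> sympart \<Rightarrow> nat set \<Rightarrow> nat" where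
  "row_stretch M P R =
     card {D \<in> snd P. conflict D (\<Union>{C \<in> snd P. C = R \<or> nonconstant_zone M R C})}"

definition col_stretch :: "'a mat \<Rightarrow> sympart \<Rightarrow> nat set \<Rightarrow> nat" where
  "col_stretch M P C =
     card {D \<in> fst P. conflict D (\<Union>{R \<in> fst P. R = C \<or> nonconstant_zone M R C})}"

definition stretch_value :: "'a mat \<Rightarrow> sympart \<Rightarrow> nat" where
  "stretch_value M P = Max (row_stretch M P ` fst P \<union> col_stretch M P ` snd P)"

text \<open>
  For matrices of dimension at least 1 a symmetric partition sequence always exists, so this
  infimum of a set of natural numbers is a minimum.
\<close>

definition stw :: "'a mat \<Rightarrow> nat" where
  "stw M = (INF Ps\<in>{Ps. symmetric_partition_sequence (dim_row M) Ps}.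
              Max (stretch_value M ` set Ps))"

definition division :: "nat \<Rightarrow> sympart \<Rightarrow> bool" where
  "division n P \<longleftrightarrow> symmetric_partition n P \<and> (\<forall>S\<in>fst P \<union> snd P. S = index_span S)"

text \<open>For a partition of an index set into intervals, the list is uniquely determined.\<close>

definition in_order :: "nat set set \<Rightarrow> nat set list \<Rightarrow> bool" where
  "in_order \<P> Ss \<longleftrightarrow> set Ss = \<P> \<and> sorted_wrt (\<lambda>A B. \<forall>a\<in>A. \<forall>b\<in>B. a < b) Ss"

text \<open>
  The union of the \<open>k\<close> consecutive parts starting at position \<open>j\<close>. Positions outside the list
  contribute no part. A window truncated in this way is only relevant if there are fewer than
  \<open>k\<close> parts: otherwise it lies inside a full window, and shrinking the window can only increase
  the number of distinct rows outside it. With fewer than \<open>k\<close> parts there is no full window,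
  and without truncation every part would be vacuously \<open>k\<close>-wide (in particular, no sequence of
  \<open>k\<close>-diagonal divisions could reach its final, single-part division).
\<close>

definition window :: "nat set list \<Rightarrow> nat \<Rightarrow> int \<Rightarrow> nat set" where
  "window Ss k j = \<Union>{Ss ! l |l. l < length Ss \<and> j \<le> int l \<and> int l \<le> j + int k - 1}"

definition row_wide :: "'a mat \<Rightarrow> nat \<Rightarrow> nat set list \<Rightarrow> nat set list \<Rightarrow> nat \<Rightarrow> bool" where
  "row_wide M k Rs Cs i \<longleftrightarrow>
     (\<forall>j. j \<le> int i \<and> int i \<le> j + int k - 1 \<longrightarrow>
        k \<le> card (set (rows (submatrix M (Rs ! i) ({..<dim_col M} - window Cs k j)))))"

definition col_wide :: "'a mat \<Rightarrow> nat \<Rightarrow> nat set list \<Rightarrow> nat set list \<Rightarrow> nat \<Rightarrow> bool" where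
  "col_wide M k Rs Cs i \<longleftrightarrow>
     (\<forall>j. j \<le> int i \<and> int i \<le> j + int k - 1 \<longrightarrow>
        k \<le> card (set (cols (submatrix M ({..<dim_row M} - window Rs k j) (Cs ! i)))))"

definition diagonal_division :: "'a mat \<Rightarrow> nat \<Rightarrow> sympart \<Rightarrow> bool" where
  "diagonal_division M k P \<longleftrightarrow>
     division (dim_row M) P \<and>
     (\<exists>Rs Cs. in_order (fst P) Rs \<and> in_order (snd P) Cs \<and>
        (\<forall>i<length Rs. \<not> row_wide M k Rs Cs i) \<and>
        (\<forall>i<length Cs. \<not> col_wide M k Rs Cs i))"

definition diagonal_division_sequence :: "'a mat \<Rightarrow> nat \<Rightarrow> sympart list \<Rightarrow> bool" where
  "diagonal_division_sequence M k Ds \<longleftrightarrow>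
     symmetric_partition_sequence (dim_row M) Ds \<and> (\<forall>D\<in>set Ds. diagonal_division M k D)"

end

theory Submission
  imports Defs
begin

text \<open>
  Given a \<open>k\<close>-diagonal division, call two indices near if at most \<open>k\<close> parts lie on or between
  them, and refine the division by identifying two indices of a part if their rows agree in all
  columns that are not near. As no part is \<open>k\<close>-wide, every part splits into fewer than \<open>k\<close>
  classes; by symmetry of the matrix, zones of classes that are not near are constant. Fixing the
  window in this way, instead of choosing one that witnesses that a part is not \<open>k\<close>-wide, makes
  the refinement monotone: merging two parts of the division only coarsens it, so the refinements
  can be joined by arbitrary merges. A partition between two consecutive refinements has at most
  \<open>2 * k\<close> parts in each part of the coarser division, and at most \<open>2 * k\<close> parts of that
  division are near a given index.
\<close>

section \<open>Elementary facts on partitions\<close>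

lemma partition_on_same_part:
  assumes "partition_on S P" "A \<in> P" "B \<in> P" "x \<in> A" "x \<in> B"
  shows "A = B"
  using assms by (auto simp: partition_on_def disjoint_def)

lemma partition_on_obtain:
  assumes "partition_on S P" "x \<in> S"
  obtains A where "A \<in> P" "x \<in> A"
  using assms by (auto simp: partition_on_def)

lemma partition_on_nonempty_part:
  assumes "partition_on S P" "A \<in> P"
  obtains x where "x \<in> A" "x \<in> S"
proof -
  have "A \<noteq> {}" "A \<subseteq> S" using assms by (auto simp: partition_on_def)
  then show ?thesis using that by blast
qed

text \<open>Picking in each part a member with value in \<open>F\<close> gives an injection, because
  a common value forces equal parts. It serves to count agreement classes by distinct rows of a
  submatrix.\<close>

lemma partition_on_card_le:
  assumes "finite F" "partition_on S P" "\<And>A. A \<in> Q \<Longrightarrow> A \<in> P \<and> (\<exists>x\<in>A. f x \<in> F)"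
    and "\<And>x y A B. A \<in> Q \<Longrightarrow> B \<in> Q \<Longrightarrow> x \<in> A \<Longrightarrow> y \<in> B \<Longrightarrow> f x = f y \<Longrightarrow> A = B"
  shows "card Q \<le> card F"
proof -
  define g where "g A = f (SOME x. x \<in> A \<and> f x \<in> F)" for A
  have g: "\<exists>x\<in>A. g A = f x \<and> f x \<in> F" if "A \<in> Q" for A
    using assms(3)[OF that] someI_ex[of "\<lambda>x. x \<in> A \<and> f x \<in> F"] unfolding g_def by blast
  have "inj_on g Q"
    using g assms(4) by (metis (no_types, lifting) inj_onI)
  moreover have "g ` Q \<subseteq> F" using g by force
  ultimately show ?thesis using assms(1) by (metis card_inj_on_le)
qed

section \<open>Nearness\<close>

text \<open>A division reduced to one partition, since its row and column parts are the same index
  sets. Convexity replaces \<open>S = index_span S\<close>, which avoids \<open>Min\<close> and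
  \<open>Max\<close>.\<close>

definition interval_partition :: "nat \<Rightarrow> nat set set \<Rightarrow> bool" where
  "interval_partition n D \<longleftrightarrow>
     partition_on {..<n} D \<and> (\<forall>A\<in>D. \<forall>x\<in>A. \<forall>z\<in>A. {x..z} \<subseteq> A)"

text \<open>Counting parts, rather than comparing positions in an ordered list, lets merges of parts
  only enlarge the relation. In an interval partition the indices near \<open>x\<close> reach over
  up to \<open>k\<close> parts on either side, the part of \<open>x\<close> included, and so cover
  every window of \<open>k\<close> consecutive parts around it.\<close>

definition near :: "nat \<Rightarrow> nat set set \<Rightarrow> nat \<Rightarrow> nat \<Rightarrow> bool" where
  "near k D x z \<longleftrightarrow> card {C \<in> D. C \<inter> {min x z..max x z} \<noteq> {}} \<le> k"

lemma near_sym: "near k D x z \<longleftrightarrow> near k D z x"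
  by (simp add: near_def min.commute max.commute)

lemma near_between:
  assumes "finite D" "near k D x z" "min x z \<le> w" "w \<le> max x z"
  shows "near k D x w"
proof -
  have "{C \<in> D. C \<inter> {min x w..max x w} \<noteq> {}} \<subseteq> {C \<in> D. C \<inter> {min x z..max x z} \<noteq> {}}"
    using assms(3,4) by (fastforce simp: min_def max_def split: if_splits)
  moreover have "finite {C \<in> D. C \<inter> {min x z..max x z} \<noteq> {}}" using assms(1) by simp
  ultimately show ?thesis
    using assms(2) unfolding near_def by (meson card_mono le_trans)
qed

text \<open>The index \<open>w\<close> lies between \<open>u\<close> and \<open>x\<close> or between
  \<open>x\<close> and \<open>v\<close>. Hence the span of a set of near indices is near as well,
  which is what bounding conflicts requires.\<close>

lemma near_convex:
  assumes "finite D" "near k D x u" "near k D x v" "u \<le> w" "w \<le> v"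
  shows "near k D x w"
  using near_between[OF assms(1,2), of w] near_between[OF assms(1,3), of w] assms(4,5)
  by (cases "w \<le> x") auto

text \<open>Sending a part to the coarser part around it maps the parts that meet the interval onto
  the coarser parts that meet it, so their number cannot grow.\<close>

lemma near_refines:
  assumes "refines {..<n} D D'" "near k D x z"
  shows "near k D' x z"
proof -
  have part: "partition_on {..<n} D" "partition_on {..<n} D'"
    using assms(1) by (auto simp: refines_def)
  let ?S = "{C \<in> D. C \<inter> {min x z..max x z} \<noteq> {}}"
  let ?S' = "{C \<in> D'. C \<inter> {min x z..max x z} \<noteq> {}}"
  obtain g where g: "\<And>C. C \<in> D \<Longrightarrow> g C \<in> D' \<and> C \<subseteq> g C"
    using assms(1) unfolding refines_def by metis
  have "?S' \<subseteq> g ` ?S"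
  proof
    fix C' assume "C' \<in> ?S'"
    then obtain w where w: "C' \<in> D'" "w \<in> C'" "w \<in> {min x z..max x z}" by blast
    then have "w \<in> {..<n}" using part(2) by (auto simp: partition_on_def)
    then obtain C where C: "C \<in> D" "w \<in> C" by (rule partition_on_obtain[OF part(1)])
    with g have "w \<in> g C" "g C \<in> D'" by auto
    then have "g C = C'" using partition_on_same_part[OF part(2)] w by blast
    then show "C' \<in> g ` ?S" using C w by blast
  qed
  moreover have "finite ?S" using finite_elements[OF _ part(1)] by simp
  ultimately have "card ?S' \<le> card ?S"
    by (meson card_image_le card_mono finite_imageI le_trans)
  then show ?thesis using assms(2) unfolding near_def by simp
qed

text \<open>Both intervals meet \<open>A\<close>. Any other part meets one of them outside
  \<open>A\<close>, and since \<open>A\<close> has no gaps, that point lies beyond all of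
  \<open>A\<close> towards \<open>z\<close>, hence in the other interval too. So the set of near
  columns depends only on the part of the row.\<close>

lemma near_same_part:
  assumes "interval_partition n D" "A \<in> D" "x \<in> A" "y \<in> A"
  shows "near k D x z \<longleftrightarrow> near k D y z"
proof -
  have conv: "\<And>u v w. u \<in> A \<Longrightarrow> v \<in> A \<Longrightarrow> u \<le> w \<Longrightarrow> w \<le> v \<Longrightarrow> w \<in> A"
    using assms(1,2) by (force simp: interval_partition_def)
  have part: "partition_on {..<n} D" using assms(1) by (simp add: interval_partition_def)
  have *: "C \<inter> {min b z..max b z} \<noteq> {}"
    if C: "C \<in> D" "C \<inter> {min a z..max a z} \<noteq> {}" and ab: "a \<in> A" "b \<in> A" for C a b
  proof -
    obtain w where w: "w \<in> C" "min a z \<le> w" "w \<le> max a z" using C(2) by auto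
    show ?thesis
    proof (cases "w \<in> A")
      case True
      then have "C = A" using partition_on_same_part[OF part C(1) assms(2) w(1)] by simp
      then show ?thesis using ab by force
    next
      case False
      then have "min b z \<le> w \<and> w \<le> max b z"
        using conv[OF ab, of w] conv[OF ab(2,1), of w] w(2,3) by linarith
      then show ?thesis using w(1) by auto
    qed
  qed
  have "{C \<in> D. C \<inter> {min x z..max x z} \<noteq> {}} = {C \<in> D. C \<inter> {min y z..max y z} \<noteq> {}}"
    using *[of _ x y] *[of _ y x] assms(3,4) by blast
  then show ?thesis by (simp add: near_def)
qed

lemma near_in_part:
  assumes "interval_partition n D" "A \<in> D" "x \<in> A" "y \<in> A" "0 < k"
  shows "near k D x y"
proof -
  have part: "partition_on {..<n} D" using assms(1) by (simp add: interval_partition_def)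
  have "{min x y..max x y} \<subseteq> A"
    using assms(1-4) by (auto simp: interval_partition_def min_def max_def)
  then have "{C \<in> D. C \<inter> {min x y..max x y} \<noteq> {}} \<subseteq> {A}"
    using partition_on_same_part[OF part _ assms(2)] by blast
  then have "card {C \<in> D. C \<inter> {min x y..max x y} \<noteq> {}} \<le> card {A}"
    by (intro card_mono) auto
  then show ?thesis using assms(5) by (simp add: near_def)
qed

text \<open>On each side of \<open>x\<close>, the interval from \<open>x\<close> to the farthest
  near index meets at most \<open>k\<close> parts and contains all near indices of that side. The
  part of \<open>x\<close> may be counted on both sides.\<close>

lemma card_near_parts_le:
  assumes "interval_partition n D"
  shows "card {B \<in> D. \<exists>z\<in>B. near k D x z} \<le> 2 * k"
proof -
  let ?N = "{z. z < n \<and> near k D x z}"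
  have part: "partition_on {..<n} D" using assms by (simp add: interval_partition_def)
  have fin: "finite D" using finite_elements[OF _ part] by simp
  \<comment> \<open>The predicate \<open>T\<close> selects a side of \<open>x\<close>; the premise
    supplies the farthest index, which is \<open>Max S\<close> above \<open>x\<close> and
    \<open>Min S\<close> below.\<close>
  have half: "card {B \<in> D. \<exists>z\<in>B. near k D x z \<and> T z} \<le> k"
    if T: "\<And>S. finite S \<Longrightarrow> S \<noteq> {} \<Longrightarrow> (\<And>z. z \<in> S \<Longrightarrow> T z)
      \<Longrightarrow> \<exists>m\<in>S. S \<subseteq> {min x m..max x m}" for T :: "nat \<Rightarrow> bool"
  proof (cases "{z \<in> ?N. T z} = {}")
    case True
    moreover have "\<And>B z. B \<in> D \<Longrightarrow> z \<in> B \<Longrightarrow> z < n"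
      using part by (auto simp: partition_on_def)
    ultimately have "{B \<in> D. \<exists>z\<in>B. near k D x z \<and> T z} = {}" by blast
    then show ?thesis by (simp only: card.empty)
  next
    case False
    have "\<exists>m\<in>{z \<in> ?N. T z}. {z \<in> ?N. T z} \<subseteq> {min x m..max x m}"
      by (rule T[OF _ False]) auto
    then obtain m where m: "m \<in> {z \<in> ?N. T z}" "{z \<in> ?N. T z} \<subseteq> {min x m..max x m}"
      by (rule bexE)
    have "{B \<in> D. \<exists>z\<in>B. near k D x z \<and> T z} \<subseteq> {C \<in> D. C \<inter> {min x m..max x m} \<noteq> {}}"
    proof safe
      fix B z assume "B \<in> D" "z \<in> B" "near k D x z" "T z" "B \<inter> {min x m..max x m} = {}"
      moreover from this have "z < n" using part by (auto simp: partition_on_def)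
      ultimately show False using m(2) by blast
    qed
    then have "card {B \<in> D. \<exists>z\<in>B. near k D x z \<and> T z} \<le> card {C \<in> D. C \<inter> {min x m..max x m} \<noteq> {}}"
      using fin by (intro card_mono) auto
    then show ?thesis using m(1) by (simp add: near_def)
  qed
  have up: "card {B \<in> D. \<exists>z\<in>B. near k D x z \<and> x \<le> z} \<le> k"
  proof (rule half)
    fix S :: "nat set" assume S: "finite S" "S \<noteq> {}" "\<And>z. z \<in> S \<Longrightarrow> x \<le> z"
    then have "S \<subseteq> {min x (Max S)..max x (Max S)}" by (auto simp: le_max_iff_disj)
    then show "\<exists>m\<in>S. S \<subseteq> {min x m..max x m}" using S Max_in by blast
  qed
  have down: "card {B \<in> D. \<exists>z\<in>B. near k D x z \<and> z \<le> x} \<le> k"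
  proof (rule half)
    fix S :: "nat set" assume S: "finite S" "S \<noteq> {}" "\<And>z. z \<in> S \<Longrightarrow> z \<le> x"
    then have "S \<subseteq> {min x (Min S)..max x (Min S)}" by (auto simp: min_le_iff_disj le_max_iff_disj)
    then show "\<exists>m\<in>S. S \<subseteq> {min x m..max x m}" using S Min_in by blast
  qed
  have "{B \<in> D. \<exists>z\<in>B. near k D x z} \<subseteq>
      {B \<in> D. \<exists>z\<in>B. near k D x z \<and> x \<le> z} \<union> {B \<in> D. \<exists>z\<in>B. near k D x z \<and> z \<le> x}"
    using nat_le_linear by blast
  then have "card {B \<in> D. \<exists>z\<in>B. near k D x z} \<le>
      card ({B \<in> D. \<exists>z\<in>B. near k D x z \<and> x \<le> z} \<union> {B \<in> D. \<exists>z\<in>B. near k D x z \<and> z \<le> x})"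
    using fin by (intro card_mono) auto
  also have "\<dots> \<le> k + k" using card_Un_le up down by (meson add_mono le_trans)
  finally show ?thesis by simp
qed

section \<open>Zones and submatrices\<close>

lemma elements_mat_submatrix_subset:
  assumes "a \<in> elements_mat (submatrix M R C)"
  shows "\<exists>i\<in>R. \<exists>j\<in>C. i < dim_row M \<and> j < dim_col M \<and> a = M $$ (i, j)"
proof -
  obtain p q where p: "p < card {i. i < dim_row M \<and> i \<in> R}"
    and q: "q < card {j. j < dim_col M \<and> j \<in> C}"
    and a: "a = M $$ (pick R p, pick C q)"
    using elements_matD[OF assms] by (auto simp: dim_submatrix submatrix_index)
  \<comment> \<open>The index sets of a submatrix may exceed the dimensions and even be infinite,
    where \<open>card\<close> is 0; hence the case distinction.\<close>
  have pick_in: "pick I r \<in> I" if "r < card {i. i < d \<and> i \<in> I}" for r d I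
  proof (rule pick_in_set)
    show "r < card I \<or> infinite I"
    proof (cases "finite I")
      case True
      then have "card {i. i < d \<and> i \<in> I} \<le> card I" by (rule card_mono) blast
      then show ?thesis using that by simp
    qed simp
  qed
  show ?thesis using pick_in[OF p] pick_in[OF q] pick_le[OF p] pick_le[OF q] a by blast
qed

text \<open>Removes the renumbering by \<open>pick\<close>, so that zones can be treated through
  entries of \<open>M\<close> at original indices.\<close>

lemma elements_mat_submatrix:
  "elements_mat (submatrix M R C) =
     {M $$ (i, j) |i j. i \<in> R \<and> j \<in> C \<and> i < dim_row M \<and> j < dim_col M}"
proof (intro equalityI subsetI)
  fix a assume "a \<in> {M $$ (i, j) |i j. i \<in> R \<and> j \<in> C \<and> i < dim_row M \<and> j < dim_col M}"
  then obtain i j where ij: "i \<in> R" "j \<in> C" "i < dim_row M" "j < dim_col M" "a = M $$ (i, j)"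
    by blast
  \<comment> \<open>The position of index \<open>i\<close> in the submatrix is the number of smaller
    selected indices; \<open>i\<close> itself makes the inclusion strict.\<close>
  have "card {b \<in> S. b < i} < card {b. b < d \<and> b \<in> S}" if "i \<in> S" "i < d" for i d :: nat and S
    using that by (intro psubset_card_mono) auto
  then show "a \<in> elements_mat (submatrix M R C)"
    using ij submatrix_index_card[OF ij(3,4,1,2)]
    by (intro elements_matI[of _ "dim_row (submatrix M R C)" "dim_col (submatrix M R C)"
          "card {b \<in> R. b < i}" "card {b \<in> C. b < j}"])
      (auto simp: dim_submatrix)
next
  fix a assume "a \<in> elements_mat (submatrix M R C)"
  then show "a \<in> {M $$ (i, j) |i j. i \<in> R \<and> j \<in> C \<and> i < dim_row M \<and> j < dim_col M}"
    using elements_mat_submatrix_subset[of a M R C] by blast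
qed

lemma symmetric_mat_index:
  assumes "transpose_mat M = M" "i < dim_row M" "j < dim_row M"
  shows "M $$ (i, j) = M $$ (j, i)"
proof -
  have "dim_col M = dim_row M" using assms(1) by (metis index_transpose_mat(2))
  then show ?thesis using index_transpose_mat(1)[of i M j] assms by simp
qed

lemma nonconstant_zone_sym:
  assumes "transpose_mat M = M"
  shows "nonconstant_zone M R C \<longleftrightarrow> nonconstant_zone M C R"
proof -
  have "dim_col M = dim_row M" using assms by (metis index_transpose_mat(2))
  then have "elements_mat (submatrix M R C) \<subseteq> elements_mat (submatrix M C R)" for R C
    unfolding elements_mat_submatrix using symmetric_mat_index[OF assms] by fastforce
  then have "elements_mat (submatrix M R C) = elements_mat (submatrix M C R)" by blast
  then show ?thesis by (simp add: nonconstant_zone_def)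
qed

text \<open>Transposing exchanges the zones of two parts, so for symmetric \<open>M\<close> it
  suffices to bound row parts.\<close>

lemma col_stretch_eq_row_stretch:
  assumes "transpose_mat M = M"
  shows "col_stretch M (P, P) C = row_stretch M (P, P) C"
  unfolding col_stretch_def row_stretch_def
  by (simp add: nonconstant_zone_sym[OF assms, of _ C])

text \<open>The number of members of \<open>R\<close> below \<open>x\<close> is the position of row
  \<open>x\<close> in the submatrix. This translates equality of submatrix rows into agreement of
  \<open>M\<close> on the columns in \<open>J\<close>.\<close>

lemma row_submatrix_eqD:
  assumes "x \<in> R" "y \<in> R" "x < dim_row M" "y < dim_row M"
    and eq: "row (submatrix M R J) (card {a \<in> R. a < x}) = row (submatrix M R J) (card {a \<in> R. a < y})"
    and "z \<in> J" "z < dim_col M"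
  shows "M $$ (x, z) = M $$ (y, z)"
proof -
  have lt: "card {b \<in> S. b < i} < card {b. b < d \<and> b \<in> S}" if "i \<in> S" "i < d" for i d :: nat and S
    using that by (intro psubset_card_mono) auto
  have entry: "row (submatrix M R J) (card {a \<in> R. a < i}) $ card {a \<in> J. a < z} = M $$ (i, z)"
    if "i \<in> R" "i < dim_row M" for i
    using that assms(6,7) submatrix_index_card[of i M z R J] lt[of i R "dim_row M"]
      lt[of z J "dim_col M"]
    by (auto simp: row_def dim_submatrix)
  show ?thesis using entry[of x] entry[of y] assms by simp
qed

section \<open>The refinement of a division\<close>

definition agree_rel :: "'a mat \<Rightarrow> nat \<Rightarrow> nat set set \<Rightarrow> (nat \<times> nat) set" where
  "agree_rel M k D = {(x, y). \<exists>A\<in>D. x \<in> A \<and> y \<in> A \<and>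
     (\<forall>z<dim_col M. \<not> near k D x z \<longrightarrow> M $$ (x, z) = M $$ (y, z))}"

definition agree_classes :: "'a mat \<Rightarrow> nat \<Rightarrow> nat \<Rightarrow> nat set set \<Rightarrow> nat set set" where
  "agree_classes M k n D = {..<n} // agree_rel M k D"

lemma agree_rel_same_part: "(x, y) \<in> agree_rel M k D \<Longrightarrow> \<exists>A\<in>D. x \<in> A \<and> y \<in> A"
  unfolding agree_rel_def by blast

lemma agree_rel_entry:
  "(x, y) \<in> agree_rel M k D \<Longrightarrow> z < dim_col M \<Longrightarrow> \<not> near k D x z \<Longrightarrow> M $$ (x, z) = M $$ (y, z)"
  unfolding agree_rel_def by blast

text \<open>The definition tests nearness from \<open>x\<close> only. Symmetry and transitivity hold
  because all members of a part have the same near columns.\<close>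

lemma equiv_agree_rel:
  assumes "interval_partition n D"
  shows "equiv {..<n} (agree_rel M k D)"
proof (rule equivI)
  have part: "partition_on {..<n} D" using assms by (simp add: interval_partition_def)
  show "agree_rel M k D \<subseteq> {..<n} \<times> {..<n}"
    using part by (auto simp: agree_rel_def partition_on_def)
  show "refl_on {..<n} (agree_rel M k D)"
    using part by (auto simp: agree_rel_def refl_on_def partition_on_def)
  show "sym (agree_rel M k D)"
  proof (rule symI)
    fix x y assume "(x, y) \<in> agree_rel M k D"
    then obtain A where A: "A \<in> D" "x \<in> A" "y \<in> A"
      and 1: "\<And>w. w < dim_col M \<Longrightarrow> \<not> near k D x w \<Longrightarrow> M $$ (x, w) = M $$ (y, w)"
      unfolding agree_rel_def by blast
    then show "(y, x) \<in> agree_rel M k D"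
      using near_same_part[OF assms A] unfolding agree_rel_def by auto
  qed
  show "trans (agree_rel M k D)"
  proof (rule transI)
    fix x y z assume "(x, y) \<in> agree_rel M k D" "(y, z) \<in> agree_rel M k D"
    then obtain A B where A: "A \<in> D" "x \<in> A" "y \<in> A" and B: "B \<in> D" "y \<in> B" "z \<in> B"
      and 1: "\<And>w. w < dim_col M \<Longrightarrow> \<not> near k D x w \<Longrightarrow> M $$ (x, w) = M $$ (y, w)"
      and 2: "\<And>w. w < dim_col M \<Longrightarrow> \<not> near k D y w \<Longrightarrow> M $$ (y, w) = M $$ (z, w)"
      unfolding agree_rel_def by blast
    have "A = B" using partition_on_same_part[OF part A(1) B(1) A(3) B(2)] .
    then show "(x, z) \<in> agree_rel M k D"
      using A B 1 2 near_same_part[OF assms A] unfolding agree_rel_def by auto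
  qed
qed

lemma agree_classes_partition:
  assumes "interval_partition n D"
  shows "partition_on {..<n} (agree_classes M k n D)"
  unfolding agree_classes_def using equiv_agree_rel[OF assms] by (rule partition_on_quotient)

lemma agree_classes_rel:
  assumes "interval_partition n D" "X \<in> agree_classes M k n D" "x \<in> X"
  shows "y \<in> X \<longleftrightarrow> (x, y) \<in> agree_rel M k D"
proof
  show "(x, y) \<in> agree_rel M k D" if "y \<in> X"
    using in_quotient_imp_in_rel[OF equiv_agree_rel[OF assms(1)]] assms(2,3) that
    unfolding agree_classes_def by blast
  show "y \<in> X" if "(x, y) \<in> agree_rel M k D"
    using in_quotient_imp_closed[OF equiv_agree_rel[OF assms(1)]] assms(2,3) that
    unfolding agree_classes_def by blast
qed

lemma agree_classes_subset:
  assumes "interval_partition n D" "X \<in> agree_classes M k n D" "x \<in> X"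
  shows "\<exists>A\<in>D. X \<subseteq> A \<and> x \<in> A"
proof -
  have part: "partition_on {..<n} D" using assms(1) by (simp add: interval_partition_def)
  obtain A where A: "A \<in> D" "x \<in> A"
    using agree_classes_rel[OF assms, of x] assms(3) agree_rel_same_part by metis
  have "y \<in> A" if y: "y \<in> X" for y
  proof -
    obtain B where "B \<in> D" "x \<in> B" "y \<in> B"
      using agree_classes_rel[OF assms, of y] y agree_rel_same_part by metis
    then show ?thesis using partition_on_same_part[OF part A(1) _ A(2)] by blast
  qed
  then show ?thesis using A by blast
qed

lemma agree_classes_refines:
  assumes "interval_partition n D"
  shows "refines {..<n} (agree_classes M k n D) D"
proof -
  have "\<exists>A\<in>D. X \<subseteq> A" if X: "X \<in> agree_classes M k n D" for X
    using partition_on_nonempty_part[OF agree_classes_partition[OF assms] X]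
      agree_classes_subset[OF assms X] by metis
  then show ?thesis
    using assms agree_classes_partition[OF assms] by (auto simp: refines_def interval_partition_def)
qed

text \<open>Coarsening the division turns far columns into near ones but never the reverse, so fewer
  columns have to agree.\<close>

lemma agree_classes_mono:
  assumes "interval_partition n D" "interval_partition n D'" "refines {..<n} D D'"
  shows "refines {..<n} (agree_classes M k n D) (agree_classes M k n D')"
proof -
  have sub: "agree_rel M k D \<subseteq> agree_rel M k D'"
  proof clarify
    fix x y assume xy: "(x, y) \<in> agree_rel M k D"
    obtain A where A: "A \<in> D" "x \<in> A" "y \<in> A" using agree_rel_same_part[OF xy] by blast
    obtain A' where "A' \<in> D'" "A \<subseteq> A'" using assms(3) A(1) by (auto simp: refines_def)
    moreover have "M $$ (x, z) = M $$ (y, z)" if "z < dim_col M" "\<not> near k D' x z" for z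
      using agree_rel_entry[OF xy that(1)] near_refines[OF assms(3)] that(2) by blast
    ultimately show "(x, y) \<in> agree_rel M k D'" using A unfolding agree_rel_def by blast
  qed
  have "\<exists>Y\<in>agree_classes M k n D'. X \<subseteq> Y" if X: "X \<in> agree_classes M k n D" for X
  proof -
    obtain x where x: "x \<in> X" "x \<in> {..<n}"
      using partition_on_nonempty_part[OF agree_classes_partition[OF assms(1)] X] .
    obtain Y where Y: "Y \<in> agree_classes M k n D'" "x \<in> Y"
      using partition_on_obtain[OF agree_classes_partition[OF assms(2)] x(2)] .
    show ?thesis
      using agree_classes_rel[OF assms(1) X x(1)] agree_classes_rel[OF assms(2) Y] sub Y(1) by blast
  qed
  then show ?thesis
    using agree_classes_partition assms(1,2) by (auto simp: refines_def)
qed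

text \<open>If \<open>x\<close> and \<open>z\<close> are far, so is every pair from \<open>X\<close>
  and \<open>Y\<close>, since each class lies in one part. Agreement in far columns, used for rows
  of both classes, then makes the whole zone constant.\<close>

lemma nonconstant_zone_near:
  assumes "M \<in> carrier_mat n n" "transpose_mat M = M" "interval_partition n D"
    and X: "X \<in> agree_classes M k n D" "R \<subseteq> X" and Y: "Y \<in> agree_classes M k n D" "C \<subseteq> Y"
    and "nonconstant_zone M R C" and xz: "x \<in> X" "z \<in> Y"
  shows "near k D x z"
proof (rule ccontr)
  assume far: "\<not> near k D x z"
  have dims: "dim_row M = n" "dim_col M = n" using assms(1) by auto
  have "X \<subseteq> {..<n}" "Y \<subseteq> {..<n}"
    using X(1) Y(1) partition_onD1[OF agree_classes_partition[OF assms(3)]] by blast+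
  then have bd: "\<And>u. u \<in> X \<Longrightarrow> u < n" "\<And>v. v \<in> Y \<Longrightarrow> v < n" by auto
  obtain A where A: "A \<in> D" "X \<subseteq> A" using agree_classes_subset[OF assms(3) X(1) xz(1)] by blast
  \<comment> \<open>Entry \<open>(x, z)\<close> equals \<open>(u, z)\<close> by agreement inside
    \<open>X\<close>; then \<open>(z, u)\<close> equals \<open>(v, u)\<close> by agreement inside
    \<open>Y\<close>, and symmetry of \<open>M\<close> links the two.\<close>
  have const: "M $$ (u, v) = M $$ (x, z)" if uv: "u \<in> X" "v \<in> Y" for u v
  proof -
    have "\<not> near k D u z" using near_same_part[OF assms(3) A(1), of u x k z] A(2) xz uv far by blast
    then have "\<not> near k D z u" by (simp add: near_sym)
    moreover have "(z, v) \<in> agree_rel M k D" using agree_classes_rel[OF assms(3) Y(1) xz(2)] uv by blast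
    ultimately have "M $$ (z, u) = M $$ (v, u)" using bd(1)[OF uv(1)] dims agree_rel_entry by metis
    moreover have "(x, u) \<in> agree_rel M k D" using agree_classes_rel[OF assms(3) X(1) xz(1)] uv by blast
    then have "M $$ (x, z) = M $$ (u, z)" using bd(2)[OF xz(2)] dims far agree_rel_entry by metis
    ultimately show ?thesis
      using symmetric_mat_index[OF assms(2)] bd uv xz dims by metis
  qed
  then have "\<And>a. a \<in> elements_mat (submatrix M R C) \<Longrightarrow> a = M $$ (x, z)"
    using X(2) Y(2) by (force simp: elements_mat_submatrix)
  then show False using assms(8) unfolding nonconstant_zone_def by metis
qed

text \<open>Every index in the union that defines the stretch value is near a fixed \<open>x\<close>
  in \<open>R\<close>, so a conflicting part lies in one of the at most \<open>2 * k\<close> parts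
  of \<open>D\<close> that contain a near index. Each of them holds at most \<open>b\<close> parts
  of \<open>Q\<close>.\<close>

lemma row_stretch_le:
  assumes "M \<in> carrier_mat n n" "transpose_mat M = M" "interval_partition n D" "0 < k"
    and Q: "refines {..<n} Q (agree_classes M k n D)" and R: "R \<in> Q"
    and b: "\<And>B. B \<in> D \<Longrightarrow> card {C \<in> Q. C \<subseteq> B} \<le> b"
  shows "row_stretch M (Q, Q) R \<le> 2 * k * b"
proof -
  have part: "partition_on {..<n} D" using assms(3) by (simp add: interval_partition_def)
  have finD: "finite D" using finite_elements[OF _ part] by simp
  have partQ: "partition_on {..<n} Q" using Q by (simp add: refines_def)
  have finQ: "finite Q" using finite_elements[OF _ partQ] by simp
  have QD: "refines {..<n} Q D"
    using refines_trans[OF Q agree_classes_refines[OF assms(3)]] .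
  obtain x where x: "x \<in> R" "x < n" using partition_on_nonempty_part[OF partQ R] by auto
  obtain X where X: "X \<in> agree_classes M k n D" "R \<subseteq> X" using Q R by (auto simp: refines_def)
  let ?U = "\<Union>{C \<in> Q. C = R \<or> nonconstant_zone M R C}"
  have U_near: "near k D x z" if "z \<in> ?U" for z
  proof -
    from that obtain C where C: "C \<in> Q" "z \<in> C" "C = R \<or> nonconstant_zone M R C" by blast
    from C(3) show ?thesis
    proof
      assume "C = R"
      moreover obtain A where "A \<in> D" "R \<subseteq> A" using QD R by (auto simp: refines_def)
      ultimately show ?thesis using near_in_part[OF assms(3) _ _ _ assms(4)] C x by blast
    next
      assume nc: "nonconstant_zone M R C"
      obtain Y where Y: "Y \<in> agree_classes M k n D" "C \<subseteq> Y" using Q C by (auto simp: refines_def)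
      show ?thesis using nonconstant_zone_near[OF assms(1-3) X Y nc] X Y x C by blast
    qed
  qed
  have Usub: "?U \<subseteq> {..<n}" using partQ by (auto simp: partition_on_def)
  then have finU: "finite ?U" by (rule finite_subset) simp
  have neU: "?U \<noteq> {}" using R x by blast
  \<comment> \<open>A common index \<open>w\<close> of the two spans need not belong to
    \<open>E\<close> or \<open>?U\<close>. It is in \<open>B\<close> because \<open>B\<close> is
    convex, and near \<open>x\<close> because nearness is convex.\<close>
  have "{E \<in> Q. conflict E ?U} \<subseteq> (\<Union>B\<in>{B \<in> D. \<exists>z\<in>B. near k D x z}. {C \<in> Q. C \<subseteq> B})"
  proof
    fix E assume "E \<in> {E \<in> Q. conflict E ?U}"
    then have E: "E \<in> Q" "conflict E ?U" by auto
    then obtain w where w: "w \<in> index_span E" "w \<in> index_span ?U" by (auto simp: conflict_def)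
    obtain B where B: "B \<in> D" "E \<subseteq> B" using QD E by (auto simp: refines_def)
    have "E \<subseteq> {..<n}" "E \<noteq> {}" using E partQ by (auto simp: partition_on_def)
    then have "Min E \<in> B" "Max E \<in> B" using B(2) by (metis Min_in Max_in finite_lessThan finite_subset subsetD)+
    then have "w \<in> B"
      using w(1) assms(3) B(1) unfolding index_span_def interval_partition_def by blast
    moreover have "near k D x w"
      using near_convex[OF finD U_near[OF Min_in[OF finU neU]] U_near[OF Max_in[OF finU neU]], of w] w(2)
      by (simp add: index_span_def)
    ultimately show "E \<in> (\<Union>B\<in>{B \<in> D. \<exists>z\<in>B. near k D x z}. {C \<in> Q. C \<subseteq> B})"
      using E B by blast
  qed
  then have "row_stretch M (Q, Q) R \<le> card (\<Union>B\<in>{B \<in> D. \<exists>z\<in>B. near k D x z}. {C \<in> Q. C \<subseteq> B})"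
    unfolding row_stretch_def using finD finQ by (auto intro!: card_mono)
  also have "\<dots> \<le> (\<Sum>B\<in>{B \<in> D. \<exists>z\<in>B. near k D x z}. card {C \<in> Q. C \<subseteq> B})"
    using finD by (intro card_UN_le) auto
  also have "\<dots> \<le> (\<Sum>B\<in>{B \<in> D. \<exists>z\<in>B. near k D x z}. b)"
    using b by (intro sum_mono) auto
  also have "\<dots> \<le> 2 * k * b"
    using card_near_parts_le[OF assms(3), of k x] by simp
  finally show ?thesis .
qed

section \<open>Diagonal divisions\<close>

text \<open>The minima of the parts form a strictly increasing list, determined by its set, and
  \<open>Min\<close> is injective on \<open>P\<close>. It identifies the row and column lists of a
  diagonal division.\<close>

lemma in_order_unique:
  assumes "in_order P Rs" "in_order P Cs" "{} \<notin> P" "\<And>A. A \<in> P \<Longrightarrow> finite A"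
  shows "Rs = Cs"
proof -
  have strict: "sorted_wrt (<) (map Min Ss)" if "in_order P Ss" for Ss
    unfolding sorted_wrt_map
  proof (rule sorted_wrt_mono_rel[rotated])
    show "sorted_wrt (\<lambda>A B. \<forall>a\<in>A. \<forall>b\<in>B. a < b) Ss" using that by (simp add: in_order_def)
  next
    fix A B assume "A \<in> set Ss" "B \<in> set Ss" "\<forall>a\<in>A. \<forall>b\<in>B. a < b"
    then show "Min A < Min B"
      using that assms(3,4) by (metis Min_in in_order_def)
  qed
  have sets: "set Rs = P" "set Cs = P" using assms(1,2) by (auto simp: in_order_def)
  have "map Min Rs = map Min Cs"
    using strict[OF assms(1)] strict[OF assms(2)] sets
    by (intro strict_sorted_equal) auto
  moreover have "distinct (map Min Rs)" using strict[OF assms(1)] strict_sorted_iff by blast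
  then have "inj_on Min P" using sets(1) by (simp add: distinct_map)
  ultimately show ?thesis using sets by (metis Un_absorb map_inj_on)
qed

text \<open>Parts that meet the interval have positions between \<open>p\<close> and
  \<open>q\<close>, which leaves at most \<open>k\<close> of them. This is the link from windows to
  nearness.\<close>

lemma near_in_order:
  assumes "in_order D Ss" "p < length Ss" "q < length Ss" "x \<in> Ss ! p" "z \<in> Ss ! q"
    and "q < p + k" "p < q + k"
  shows "near k D x z"
proof -
  have less: "\<And>i j a b. i < j \<Longrightarrow> j < length Ss \<Longrightarrow> a \<in> Ss ! i \<Longrightarrow> b \<in> Ss ! j \<Longrightarrow> a < b"
    using assms(1) unfolding in_order_def sorted_wrt_iff_nth_less by blast
  have "{C \<in> D. C \<inter> {min x z..max x z} \<noteq> {}} \<subseteq> (!) Ss ` {min p q..max p q}"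
  proof
    fix C assume "C \<in> {C \<in> D. C \<inter> {min x z..max x z} \<noteq> {}}"
    then obtain w where C: "C \<in> D" "w \<in> C" "min x z \<le> w" "w \<le> max x z" by auto
    obtain l where l: "l < length Ss" "C = Ss ! l"
      using C(1) assms(1) by (metis in_order_def in_set_conv_nth)
    have "min p q \<le> l"
    proof (rule ccontr)
      assume "\<not> min p q \<le> l"
      then have "l < p" "l < q" by auto
      then have "w < x" "w < z" using less[of l _ w] l C(2) assms(2-5) by blast+
      then show False using C(3) by simp
    qed
    moreover have "l \<le> max p q"
    proof (rule ccontr)
      assume "\<not> l \<le> max p q"
      then have "p < l" "q < l" by auto
      then have "x < w" "z < w" using less[of _ l _ w] l C(2) assms(2-5) by blast+
      then show False using C(4) by simp
    qed
    ultimately show "C \<in> (!) Ss ` {min p q..max p q}" using l by auto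
  qed
  then have "card {C \<in> D. C \<inter> {min x z..max x z} \<noteq> {}} \<le> card {min p q..max p q}"
    by (rule surj_card_le[rotated]) simp
  also have "\<dots> \<le> k" using assms(6,7) by auto
  finally show ?thesis by (simp add: near_def)
qed

text \<open>Both partitions put the same pairs of indices together, so they refine each other. From
  here on one partition stands for the pair.\<close>

lemma symmetric_partition_eq:
  assumes "symmetric_partition n P"
  shows "P = (fst P, fst P)"
proof -
  have sub: "refines {..<n} A B"
    if A: "partition_on {..<n} A" and B: "partition_on {..<n} B"
      and imp: "\<And>i j. i < n \<Longrightarrow> j < n \<Longrightarrow> \<exists>S\<in>A. i \<in> S \<and> j \<in> S \<Longrightarrow> \<exists>T\<in>B. i \<in> T \<and> j \<in> T" for A B
  proof -
    have "\<exists>T\<in>B. S \<subseteq> T" if S: "S \<in> A" for S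
    proof -
      obtain x where x: "x \<in> S" "x \<in> {..<n}" using partition_on_nonempty_part[OF A S] .
      obtain T where T: "T \<in> B" "x \<in> T" using partition_on_obtain[OF B x(2)] .
      have "y \<in> T" if y: "y \<in> S" for y
      proof -
        have "y < n" using y S A by (auto simp: partition_on_def)
        then obtain T' where "T' \<in> B" "x \<in> T'" "y \<in> T'" using imp[of x y] x S y by auto
        then show ?thesis using partition_on_same_part[OF B T(1) _ T(2)] by blast
      qed
      then show ?thesis using T by blast
    qed
    then show ?thesis using A B by (simp add: refines_def)
  qed
  have parts: "partition_on {..<n} (fst P)" "partition_on {..<n} (snd P)"
    and same: "\<And>i j. i < n \<Longrightarrow> j < n \<Longrightarrow>
      (\<exists>S\<in>fst P. i \<in> S \<and> j \<in> S) \<longleftrightarrow> (\<exists>T\<in>snd P. i \<in> T \<and> j \<in> T)"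
    using assms unfolding symmetric_partition_def by blast+
  have "refines {..<n} (fst P) (snd P)" "refines {..<n} (snd P) (fst P)"
    using sub[OF parts same[THEN iffD1]] sub[OF parts(2,1) same[THEN iffD2]] by blast+
  then have "fst P = snd P" by (rule refines_asym)
  then show ?thesis by (metis prod.collapse)
qed

lemma diagonal_division_interval:
  assumes "diagonal_division M k P" "dim_row M = n"
  shows "interval_partition n (fst P)"
proof -
  have "division n P" using assms by (simp add: diagonal_division_def)
  then have "partition_on {..<n} (fst P)" "\<And>A. A \<in> fst P \<Longrightarrow> A = {Min A..Max A}"
    by (auto simp: division_def symmetric_partition_def index_span_def)
  then show ?thesis unfolding interval_partition_def
    by (metis atLeastAtMost_iff atLeastatMost_subset_iff)
qed

text \<open>For \<open>k = 0\<close> the lower bound in \<open>row_wide\<close> is trivial, so every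
  part would be wide.\<close>

lemma diagonal_division_pos:
  assumes "diagonal_division M k P" "fst P \<noteq> {}"
  shows "0 < k"
proof (rule ccontr)
  assume "\<not> 0 < k"
  obtain Rs Cs where "in_order (fst P) Rs" "\<And>i. i < length Rs \<Longrightarrow> \<not> row_wide M k Rs Cs i"
    using assms(1) by (auto simp: diagonal_division_def)
  moreover from this have "0 < length Rs" using assms(2) by (auto simp: in_order_def)
  ultimately have "\<not> row_wide M k Rs Cs 0" by blast
  then show False using \<open>\<not> 0 < k\<close> by (simp add: row_wide_def)
qed

text \<open>As \<open>B\<close> is not wide, outside some window around it there are fewer than
  \<open>k\<close> distinct rows. The window consists of near columns, so indices of
  \<open>B\<close> whose rows coincide outside it lie in the same class.\<close>

lemma card_agree_classes_le:
  assumes "M \<in> carrier_mat n n" "diagonal_division M k P" "B \<in> fst P"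
  shows "card {X \<in> agree_classes M k n (fst P). X \<subseteq> B} \<le> k"
proof -
  let ?D = "fst P"
  have dims: "dim_row M = n" "dim_col M = n" using assms(1) by auto
  have int: "interval_partition n ?D" using diagonal_division_interval[OF assms(2) dims(1)] .
  have part: "partition_on {..<n} ?D" using int by (simp add: interval_partition_def)
  have "snd P = ?D"
    using assms(2) symmetric_partition_eq[of n P] dims
    by (metis diagonal_division_def division_def snd_conv)
  then obtain Rs Cs where Rs: "in_order ?D Rs" "in_order ?D Cs"
    and nw: "\<And>i. i < length Rs \<Longrightarrow> \<not> row_wide M k Rs Cs i"
    using assms(2) by (auto simp: diagonal_division_def)
  have "finite A" if "A \<in> ?D" for A
    using part that by (metis Union_upper finite_lessThan finite_subset partition_onD1)
  then have [simp]: "Cs = Rs" using in_order_unique[OF Rs] partition_onD3[OF part] by blast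
  obtain i where i: "i < length Rs" "Rs ! i = B"
    using Rs(1) assms(3) by (metis in_order_def in_set_conv_nth)
  obtain j where j: "j \<le> int i" "int i \<le> j + int k - 1"
    and few: "card (set (rows (submatrix M B ({..<n} - window Rs k j)))) < k"
    using nw[OF i(1)] i(2) dims by (auto simp: row_wide_def not_le)
  let ?J = "{..<n} - window Rs k j"
  let ?f = "\<lambda>x. row (submatrix M B ?J) (card {a \<in> B. a < x})"
  have B: "B \<subseteq> {..<n}" using part assms(3) by (auto simp: partition_on_def)
  \<comment> \<open>A column outside \<open>?J\<close> is in the window, which also contains
    position \<open>i\<close>; so its part is fewer than \<open>k\<close> positions away.\<close>
  have near: "near k ?D x z" if "x \<in> B" "z < n" "z \<notin> ?J" for x z
  proof -
    from that obtain l where l: "l < length Rs" "z \<in> Rs ! l" "j \<le> int l" "int l \<le> j + int k - 1"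
      by (auto simp: window_def)
    show ?thesis
      by (rule near_in_order[OF Rs(1) i(1) l(1) _ l(2)]) (use that i j l in auto)
  qed
  have "card {X \<in> agree_classes M k n ?D. X \<subseteq> B} \<le> card (set (rows (submatrix M B ?J)))"
  proof (rule partition_on_card_le[where f = ?f])
    show "finite (set (rows (submatrix M B ?J)))" by simp
    show "partition_on {..<n} (agree_classes M k n ?D)" by (rule agree_classes_partition[OF int])
  next
    fix A assume A: "A \<in> {X \<in> agree_classes M k n ?D. X \<subseteq> B}"
    then obtain x where x: "x \<in> A"
      using partition_on_nonempty_part[OF agree_classes_partition[OF int]] by blast
    then have xB: "x \<in> B" "x < n" using A B by auto
    have "card {a \<in> B. a < x} < card {a. a < n \<and> a \<in> B}"
      using xB by (intro psubset_card_mono) auto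
    then have "?f x \<in> set (rows (submatrix M B ?J))"
      by (auto simp: rows_def dim_submatrix dims)
    then show "A \<in> agree_classes M k n ?D \<and> (\<exists>x\<in>A. ?f x \<in> set (rows (submatrix M B ?J)))"
      using A x by auto
  next
    fix x y X Y assume XY: "X \<in> {X \<in> agree_classes M k n ?D. X \<subseteq> B}"
      "Y \<in> {X \<in> agree_classes M k n ?D. X \<subseteq> B}" "x \<in> X" "y \<in> Y" and eq: "?f x = ?f y"
    have xy: "x \<in> B" "y \<in> B" "x < n" "y < n" using XY B by auto
    have "M $$ (x, z) = M $$ (y, z)" if z: "z < dim_col M" "\<not> near k ?D x z" for z
    proof -
      have "z \<in> ?J" using near[OF xy(1), of z] z unfolding dims by blast
      then show ?thesis using row_submatrix_eqD[OF xy(1,2) _ _ eq _ z(1)] xy(3,4) dims by simp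
    qed
    then have "(x, y) \<in> agree_rel M k ?D" using xy(1,2) assms(3) unfolding agree_rel_def by blast
    then have "y \<in> X" using agree_classes_rel[OF int] XY by blast
    then show "X = Y"
      using partition_on_same_part[OF agree_classes_partition[OF int]] XY by blast
  qed
  then show ?thesis using few by simp
qed

section \<open>Sequences of merges\<close>

lemma merge_step_refines:
  assumes "merge_step P Q" "symmetric_partition n P" "symmetric_partition n Q"
  shows "refines {..<n} (fst P) (fst Q)"
proof -
  obtain A B where "fst Q = insert (A \<union> B) (fst P - {A, B})"
    using assms(1) by (auto simp: merge_step_def)
  then have "\<exists>Y\<in>fst Q. X \<subseteq> Y" if "X \<in> fst P" for X using that by auto
  then show ?thesis using assms(2,3) by (simp add: refines_def symmetric_partition_def)
qed

text \<open>Only the merged part contains two old parts; any other part of \<open>Q\<close> is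
  itself an old part.\<close>

lemma merge_step_card_le:
  assumes "merge_step P Q" "partition_on S (fst P)" "C \<in> fst Q"
  shows "card {X \<in> fst P. X \<subseteq> C} \<le> 2"
proof -
  obtain A B where AB: "A \<in> fst P" "B \<in> fst P" "fst Q = insert (A \<union> B) (fst P - {A, B})"
    using assms(1) by (auto simp: merge_step_def)
  have ne: "\<And>X. X \<in> fst P \<Longrightarrow> \<exists>x. x \<in> X" using partition_onD3[OF assms(2)] by (metis all_not_in_conv)
  have "{X \<in> fst P. X \<subseteq> C} \<subseteq> (if C = A \<union> B then {A, B} else {C})"
  proof
    fix X assume X: "X \<in> {X \<in> fst P. X \<subseteq> C}"
    then obtain x where x: "x \<in> X" "x \<in> C" using ne by blast
    then show "X \<in> (if C = A \<union> B then {A, B} else {C})"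
      using partition_on_same_part[OF assms(2), of X A x] partition_on_same_part[OF assms(2), of X B x]
        partition_on_same_part[OF assms(2), of X C x] AB X assms(3) by auto
  qed
  then have "card {X \<in> fst P. X \<subseteq> C} \<le> card (if C = A \<union> B then {A, B} else {C})"
    by (intro card_mono) auto
  also have "\<dots> \<le> 2" by (simp add: card_insert_if)
  finally show ?thesis .
qed

text \<open>Every part of \<open>Q\<close> inside \<open>B\<close> contains some part of
  \<open>P\<close>, which then also lies inside \<open>B\<close>.\<close>

lemma card_parts_refines_le:
  assumes "refines S P Q" "finite P"
  shows "card {C \<in> Q. C \<subseteq> B} \<le> card {X \<in> P. X \<subseteq> B}"
proof -
  have P: "partition_on S P" and Q: "partition_on S Q" using assms(1) by (auto simp: refines_def)
  obtain g where g: "\<And>X. X \<in> P \<Longrightarrow> g X \<in> Q \<and> X \<subseteq> g X"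
    using assms(1) unfolding refines_def by metis
  have "{C \<in> Q. C \<subseteq> B} \<subseteq> g ` {X \<in> P. X \<subseteq> B}"
  proof
    fix C assume C: "C \<in> {C \<in> Q. C \<subseteq> B}"
    then obtain x where x: "x \<in> C" "x \<in> S" using partition_on_nonempty_part[OF Q] by blast
    obtain X where X: "X \<in> P" "x \<in> X" using partition_on_obtain[OF P x(2)] .
    then have "g X = C" using g[OF X(1)] partition_on_same_part[OF Q, of "g X" C x] C x by auto
    then show "C \<in> g ` {X \<in> P. X \<subseteq> B}" using X g[OF X(1)] C by auto
  qed
  then show ?thesis using assms(2) by (auto intro: surj_card_le)
qed

text \<open>An initial piece of a symmetric partition sequence that ends at \<open>Q\<close>, with
  an invariant \<open>good\<close> along the way; the invariant will be the stretch bound.\<close>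

definition merge_reachable :: "nat \<Rightarrow> (sympart \<Rightarrow> bool) \<Rightarrow> nat set set \<Rightarrow> bool" where
  "merge_reachable n good Q \<longleftrightarrow> (\<exists>Ps. Ps \<noteq> [] \<and> hd Ps = singleton_partition n \<and> last Ps = (Q, Q) \<and>
     (\<forall>P\<in>set Ps. symmetric_partition n P \<and> good P) \<and>
     (\<forall>t. Suc t < length Ps \<longrightarrow> merge_step (Ps ! t) (Ps ! Suc t)))"

lemma symmetric_partition_diag: "symmetric_partition n (Q, Q) \<longleftrightarrow> partition_on {..<n} Q"
  by (auto simp: symmetric_partition_def)

lemma merge_reachable_step:
  assumes "merge_reachable n good P" "merge_step (P, P) (Q, Q)" "partition_on {..<n} Q" "good (Q, Q)"
  shows "merge_reachable n good Q"
proof -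
  obtain Ps where Ps: "Ps \<noteq> []" "hd Ps = singleton_partition n" "last Ps = (P, P)"
    "\<forall>P\<in>set Ps. symmetric_partition n P \<and> good P"
    "\<And>t. Suc t < length Ps \<Longrightarrow> merge_step (Ps ! t) (Ps ! Suc t)"
    using assms(1) by (auto simp: merge_reachable_def)
  have "merge_step ((Ps @ [(Q, Q)]) ! t) ((Ps @ [(Q, Q)]) ! Suc t)"
    if "Suc t < length (Ps @ [(Q, Q)])" for t
  proof (cases "Suc t < length Ps")
    case True
    then show ?thesis using Ps(5) by (simp add: nth_append)
  next
    case False
    then have "Suc t = length Ps" using that by simp
    then have "t = length Ps - 1" "t < length Ps" by auto
    then show ?thesis using Ps(1,3) assms(2) \<open>Suc t = length Ps\<close>
      by (simp add: nth_append last_conv_nth)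
  qed
  then show ?thesis
    unfolding merge_reachable_def using Ps(1-4) assms(3,4)
    by (intro exI[of _ "Ps @ [(Q, Q)]"]) (auto simp: symmetric_partition_diag)
qed

text \<open>Some part \<open>Y\<close> of \<open>P'\<close> is contained in no part of
  \<open>P\<close>, hence meets two of them. Both lie inside \<open>Y\<close> by refinement, so
  merging them stays below \<open>P'\<close>.\<close>

lemma refines_merge:
  assumes "refines S P P'" "P \<noteq> P'"
  obtains A B where "A \<in> P" "B \<in> P" "A \<noteq> B"
    "refines S P (insert (A \<union> B) (P - {A, B}))" "refines S (insert (A \<union> B) (P - {A, B})) P'"
proof -
  have P: "partition_on S P" and P': "partition_on S P'" using assms(1) by (auto simp: refines_def)
  have "\<not> refines S P' P" using refines_asym assms by blast
  then obtain Y where Y: "Y \<in> P'" "\<And>X. X \<in> P \<Longrightarrow> \<not> Y \<subseteq> X" using P P' by (auto simp: refines_def)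
  obtain a where a: "a \<in> Y" "a \<in> S" using partition_on_nonempty_part[OF P' Y(1)] .
  obtain A where A: "A \<in> P" "a \<in> A" using partition_on_obtain[OF P a(2)] .
  obtain b where b: "b \<in> Y" "b \<notin> A" using Y(2)[OF A(1)] by blast
  have "b \<in> S" using P' Y(1) b(1) by (auto simp: partition_on_def)
  then obtain B where B: "B \<in> P" "b \<in> B" using partition_on_obtain[OF P] by blast
  have sub: "X \<subseteq> Y" if X: "X \<in> P" "x \<in> X" "x \<in> Y" for X x
  proof -
    obtain Z where "Z \<in> P'" "X \<subseteq> Z" using assms(1) X(1) by (auto simp: refines_def)
    then show ?thesis using partition_on_same_part[OF P' Y(1), of Z x] X by auto
  qed
  let ?Q = "insert (A \<union> B) (P - {A, B})"
  have "partition_on S ?Q"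
  proof (rule partition_onI)
    show "\<Union>?Q = S" using P A(1) B(1) by (auto simp: partition_on_def)
    show "{} \<notin> ?Q" using partition_onD3[OF P] A(2) by auto
  next
    fix p q assume "p \<in> ?Q" "q \<in> ?Q" "p \<noteq> q"
    then show "disjnt p q"
      using partition_on_same_part[OF P] A(1) B(1) by (auto simp: disjnt_iff)
  qed
  then have "refines S P ?Q" "refines S ?Q P'"
    using assms(1) sub[OF A a(1)] sub[OF B b(1)] Y(1) by (auto simp: refines_def)
  moreover have "A \<noteq> B" using b B by auto
  ultimately show ?thesis using that A B by blast
qed

text \<open>Merges inside parts of \<open>P'\<close> are repeated until \<open>P'\<close> is
  reached; each lowers the number of parts and stays between \<open>P\<close> and \<open>P'\<close>,
  where \<open>good\<close> is assumed.\<close>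

lemma merge_reachable_refines:
  assumes "merge_reachable n good P" "refines {..<n} P P'"
    and "\<And>Q. refines {..<n} P Q \<Longrightarrow> refines {..<n} Q P' \<Longrightarrow> good (Q, Q)"
  shows "merge_reachable n good P'"
  using assms
proof (induction "card P" arbitrary: P rule: less_induct)
  case less
  show ?case
  proof (cases "P = P'")
    case False
    obtain A B where AB: "A \<in> P" "B \<in> P" "A \<noteq> B"
      and ref: "refines {..<n} P (insert (A \<union> B) (P - {A, B}))"
        "refines {..<n} (insert (A \<union> B) (P - {A, B})) P'"
      using refines_merge[OF less.prems(2) False] .
    let ?Q = "insert (A \<union> B) (P - {A, B})"
    have P: "partition_on {..<n} P" and Q: "partition_on {..<n} ?Q" using ref by (auto simp: refines_def)
    have "finite P" using finite_elements[OF _ P] by simp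
    then have "card {A, B} \<le> card P" using AB by (intro card_mono) auto
    moreover have "card (P - {A, B}) = card P - card {A, B}" using AB by (intro card_Diff_subset) auto
    moreover have "card ?Q \<le> Suc (card (P - {A, B}))" by (rule card_insert_le_m1) auto
    ultimately have "card ?Q < card P" using AB(3) by simp
    moreover have "merge_step (P, P) (?Q, ?Q)" using AB by (auto simp: merge_step_def)
    then have "merge_reachable n good ?Q"
      using merge_reachable_step[OF less.prems(1) _ Q] less.prems(3)[OF ref] by blast
    ultimately show ?thesis
      using less.hyps[OF _ _ ref(2)] less.prems(3) refines_trans[OF ref(1)] by blast
  next
    case True
    then show ?thesis using less.prems(1) by (rule subst)
  qed
qed

section \<open>The stretch bound and the assembly of the sequence\<close>

text \<open>Nearness is taken in the later division \<open>P'\<close>. Each of its parts consists of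
  at most two parts of \<open>P\<close>, each with at most \<open>k\<close> classes, so it holds at
  most \<open>2 * k\<close> parts of \<open>Q\<close>. The alternative \<open>P = P'\<close> serves
  the start of the sequence.\<close>

lemma stretch_value_le:
  assumes M: "M \<in> carrier_mat n n" "transpose_mat M = M" and "0 < n"
    and P: "diagonal_division M k P" and P': "diagonal_division M k P'"
    and step: "P = P' \<or> merge_step P P'"
    and Q: "refines {..<n} (agree_classes M k n (fst P)) Q"
      "refines {..<n} Q (agree_classes M k n (fst P'))"
  shows "stretch_value M (Q, Q) \<le> 4 * k ^ 3"
proof -
  have dims: "dim_row M = n" using M by auto
  let ?D = "fst P" and ?D' = "fst P'"
  have int: "interval_partition n ?D" "interval_partition n ?D'"
    using diagonal_division_interval[OF _ dims] P P' by auto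
  have part: "partition_on {..<n} ?D" "partition_on {..<n} ?D'"
    using int by (auto simp: interval_partition_def)
  have fin: "finite ?D" using finite_elements[OF _ part(1)] by simp
  have k: "0 < k" using diagonal_division_pos[OF P] part(1) assms(3) by (auto simp: partition_on_def)
  have two: "card {X \<in> ?D. X \<subseteq> B} \<le> 2" if B: "B \<in> ?D'" for B
    using step
  proof
    assume "P = P'"
    then have BD: "B \<in> ?D" using B by simp
    have "{X \<in> ?D. X \<subseteq> B} \<subseteq> {B}"
    proof
      fix X assume X: "X \<in> {X \<in> ?D. X \<subseteq> B}"
      then obtain x where "x \<in> X" using partition_on_nonempty_part[OF part(1)] by blast
      then show "X \<in> {B}" using partition_on_same_part[OF part(1) _ BD] X by blast
    qed
    then have "card {X \<in> ?D. X \<subseteq> B} \<le> card {B}" by (intro card_mono) auto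
    then show ?thesis by simp
  next
    assume "merge_step P P'"
    then show ?thesis by (rule merge_step_card_le[OF _ part(1) B])
  qed
  have DD': "refines {..<n} ?D ?D'"
    using step refines_refl[OF part(2)] merge_step_refines P P' dims
    by (metis diagonal_division_def division_def)
  let ?K = "agree_classes M k n ?D"
  have partK: "partition_on {..<n} ?K" using agree_classes_partition[OF int(1)] .
  have finK: "finite ?K" using finite_elements[OF _ partK] by simp
  have b: "card {C \<in> Q. C \<subseteq> B} \<le> 2 * k" if B: "B \<in> ?D'" for B
  proof -
    have "{X \<in> ?K. X \<subseteq> B} \<subseteq> (\<Union>A\<in>{A \<in> ?D. A \<subseteq> B}. {X \<in> ?K. X \<subseteq> A})"
    proof
      fix X assume X: "X \<in> {X \<in> ?K. X \<subseteq> B}"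
      then obtain x where x: "x \<in> X" using partition_on_nonempty_part[OF partK] by blast
      obtain A where A: "A \<in> ?D" "X \<subseteq> A"
        using agree_classes_subset[OF int(1) _ x] X by blast
      obtain B' where B': "B' \<in> ?D'" "A \<subseteq> B'" using DD' A by (auto simp: refines_def)
      have "B' = B" using partition_on_same_part[OF part(2) B'(1) B, of x] x A B' X by auto
      then show "X \<in> (\<Union>A\<in>{A \<in> ?D. A \<subseteq> B}. {X \<in> ?K. X \<subseteq> A})" using A B' X by blast
    qed
    then have "card {X \<in> ?K. X \<subseteq> B} \<le> card (\<Union>A\<in>{A \<in> ?D. A \<subseteq> B}. {X \<in> ?K. X \<subseteq> A})"
      using fin finK by (intro card_mono) auto
    also have "\<dots> \<le> (\<Sum>A\<in>{A \<in> ?D. A \<subseteq> B}. card {X \<in> ?K. X \<subseteq> A})"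
      using fin by (intro card_UN_le) auto
    also have "\<dots> \<le> (\<Sum>A\<in>{A \<in> ?D. A \<subseteq> B}. k)"
      using card_agree_classes_le[OF M(1) P] by (intro sum_mono) auto
    also have "\<dots> \<le> 2 * k" using two[OF B] by simp
    finally show ?thesis using card_parts_refines_le[OF Q(1) finK, of B] by simp
  qed
  have row: "row_stretch M (Q, Q) R \<le> 4 * k ^ 3" if "R \<in> Q" for R
  proof -
    have "row_stretch M (Q, Q) R \<le> 2 * k * (2 * k)"
      by (rule row_stretch_le[OF M int(2) k Q(2) that b])
    \<comment> \<open>The argument yields a quadratic bound; positivity of \<open>k\<close> turns it
      into the cubic one.\<close>
    also have "\<dots> = 4 * k ^ 2" by (simp add: power2_eq_square)
    also have "\<dots> \<le> 4 * k ^ 3" using k by (intro mult_le_mono2 power_increasing) auto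
    finally show ?thesis .
  qed
  have partQ: "partition_on {..<n} Q" using Q by (simp add: refines_def)
  have "finite Q" using finite_elements[OF _ partQ] by simp
  moreover have "Q \<noteq> {}" using partQ assms(3) by (auto simp: partition_on_def)
  ultimately show ?thesis
    unfolding stretch_value_def using row col_stretch_eq_row_stretch[OF M(2)] by auto
qed

lemma refines_singletons:
  assumes "refines S P ((\<lambda>x. {x}) ` S)"
  shows "P = (\<lambda>x. {x}) ` S"
proof -
  have P: "partition_on S P" using assms unfolding refines_def by blast
  have "\<exists>Y\<in>P. {x} \<subseteq> Y" if "x \<in> S" for x
    using partition_on_obtain[OF P that] by blast
  then have "refines S ((\<lambda>x. {x}) ` S) P"
    unfolding refines_def using P partition_on_singletons by blast
  with assms show ?thesis by (rule refines_asym)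
qed

text \<open>The refinement of the singleton division is that division itself. Monotonicity then lets
  arbitrary merges lead from each refinement to the next, under the stretch bound for all partitions
  in between.\<close>

lemma merge_reachable_agree_classes:
  assumes M: "M \<in> carrier_mat n n" "transpose_mat M = M" "0 < n"
    and Ds: "diagonal_division_sequence M k Ds" and "t < length Ds"
  shows "merge_reachable n (\<lambda>P. stretch_value M P \<le> 4 * k ^ 3) (agree_classes M k n (fst (Ds ! t)))"
proof -
  have dims: "dim_row M = n" using M by auto
  have diag: "\<And>D. D \<in> set Ds \<Longrightarrow> diagonal_division M k D"
    using Ds by (simp add: diagonal_division_sequence_def)
  note int = diagonal_division_interval[OF diag dims]
  show ?thesis
    using assms(5)
  proof (induction t)
    case 0
    then have D0: "Ds ! 0 \<in> set Ds" by (rule nth_mem)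
    have hd: "Ds ! 0 = singleton_partition n"
      using Ds dims by (auto simp: diagonal_division_sequence_def symmetric_partition_sequence_def hd_conv_nth)
    let ?K = "agree_classes M k n (fst (Ds ! 0))"
    have K: "?K = (\<lambda>x. {x}) ` {..<n}"
      using refines_singletons agree_classes_refines[OF int[OF D0], of M k] hd
      by (simp add: singleton_partition_def)
    have ref: "refines {..<n} ?K ?K"
      using refines_refl agree_classes_partition[OF int[OF D0]] by blast
    have "stretch_value M (?K, ?K) \<le> 4 * k ^ 3"
      using stretch_value_le[OF M diag diag _ ref ref] D0 by blast
    moreover have "(?K, ?K) = singleton_partition n" using K by (simp add: singleton_partition_def)
    moreover have "symmetric_partition n (?K, ?K)"
      using ref by (simp add: symmetric_partition_diag refines_def)
    ultimately show ?case
      unfolding merge_reachable_def by (intro exI[of _ "[(?K, ?K)]"]) auto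
  next
    case (Suc t)
    have mem: "Ds ! t \<in> set Ds" "Ds ! Suc t \<in> set Ds" using Suc.prems by auto
    have step: "merge_step (Ds ! t) (Ds ! Suc t)" and sym: "\<And>D. D \<in> set Ds \<Longrightarrow> symmetric_partition n D"
      using Ds Suc.prems dims by (auto simp: diagonal_division_sequence_def symmetric_partition_sequence_def)
    show ?case
    proof (rule merge_reachable_refines)
      show "refines {..<n} (agree_classes M k n (fst (Ds ! t))) (agree_classes M k n (fst (Ds ! Suc t)))"
        using agree_classes_mono int mem merge_step_refines[OF step] sym by blast
      show "merge_reachable n (\<lambda>P. stretch_value M P \<le> 4 * k ^ 3) (agree_classes M k n (fst (Ds ! t)))"
        using Suc by simp
    qed (rule stretch_value_le[OF M diag[OF mem(1)] diag[OF mem(2)] disjI2[OF step]])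
  qed
qed

theorem theorem21:
  fixes M :: "'a::zero_neq_one mat" and n k :: nat
  assumes "M \<in> carrier_mat n n"
    and "elements_mat M \<subseteq> {0, 1}"
    and "transpose_mat M = M"
    and "\<exists>Ds. diagonal_division_sequence M k Ds"
  shows "stw M \<le> 4 * k ^ 3"
proof -
  obtain Ds where Ds: "diagonal_division_sequence M k Ds" using assms(4) by blast
  have dims: "dim_row M = n" using assms(1) by auto
  let ?L = "last Ds"
  have "Ds \<noteq> []" and card1: "card (fst ?L) = 1"
    using Ds by (auto simp: diagonal_division_sequence_def symmetric_partition_sequence_def)
  then have L: "?L = Ds ! (length Ds - 1)" "length Ds - 1 < length Ds" "?L \<in> set Ds"
    by (auto simp: last_conv_nth)
  have diag: "diagonal_division M k ?L" using Ds L(3) by (simp add: diagonal_division_sequence_def)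
  have int: "interval_partition n (fst ?L)" using diagonal_division_interval[OF diag dims] .
  obtain A where A: "fst ?L = {A}" using card1 card_1_singletonE by blast
  have "A = {..<n}" "A \<noteq> {}" using int A by (auto simp: interval_partition_def partition_on_def)
  then have n: "0 < n" and A: "fst ?L = {{..<n}}" using A by auto
  have k: "0 < k" using diagonal_division_pos[OF diag] A by simp
  let ?K = "agree_classes M k n (fst ?L)"
  \<comment> \<open>The last division has a single part, so all columns are near and no agreement is
    demanded. Its refinement is therefore one class, and the merges form a complete partition
    sequence.\<close>
  have "near k (fst ?L) x y" if "x < n" "y < n" for x y
    using near_in_part[OF int _ _ _ k] that A by auto
  then have "agree_rel M k (fst ?L) = {..<n} \<times> {..<n}"
    using A assms(1) by (auto simp: agree_rel_def)
  then have K: "?K = {{..<n}}" using n by (auto simp: agree_classes_def quotient_def)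
  have "merge_reachable n (\<lambda>P. stretch_value M P \<le> 4 * k ^ 3) ?K"
    using merge_reachable_agree_classes[OF assms(1,3) n Ds L(2)] L(1) by simp
  then obtain Ps where Ps: "Ps \<noteq> []" "hd Ps = singleton_partition n" "last Ps = ({{..<n}}, {{..<n}})"
    "\<And>P. P \<in> set Ps \<Longrightarrow> symmetric_partition n P \<and> stretch_value M P \<le> 4 * k ^ 3"
    "\<And>t. Suc t < length Ps \<Longrightarrow> merge_step (Ps ! t) (Ps ! Suc t)"
    unfolding merge_reachable_def K by blast
  then have "symmetric_partition_sequence (dim_row M) Ps"
    by (simp add: symmetric_partition_sequence_def dims)
  then have "stw M \<le> Max (stretch_value M ` set Ps)"
    unfolding stw_def by (intro cINF_lower) auto
  also have "\<dots> \<le> 4 * k ^ 3" using Ps(1,4) by auto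
  finally show ?thesis .
qed

end
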